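(* Let $x_1,\dots,x_n\in\mathbb{R}^d$ and $\sigma>0$, and let $(X_t)_{t\ge0}$ be the Markov chain on $\{x_1,\dots,x_n\}$ with transition probabilities $$\mathbb{P}(X_t=x_j\mid X_{t-1}=x_i)=\frac{\exp(-\|x_i-x_j\|_2^2/\sigma^2)}{\sum_{k=1}^n\exp(-\|x_i-x_k\|_2^2/\sigma^2)} .$$ Let $C_{ij}$ be the number of times that $X_{t-1}=x_i$ and $X_t=x_j$ over $m$ steps. Let $a_i^m,b_j^m$ ($m\ge1$, $1\le i,j\le n$) be real constants such that $$\sup_{i,j}\left|-\log(C_{ij})-\|x_i-x_j\|_2^2/\sigma^2+a_i^m+b_j^m\right|\to0\quad\text{in probability as } m\to\infty .$$ Define the GloVe objective, for $\widehat{x},\widehat{c}\in(\mathbb{R}^d)^n$ and $\widehat{a},\widehat{b}\in\mathbb{R}^n$, by $$g(\widehat{x},\widehat{c},\widehat{a},\widehat{b})=\sum_{i,j}f(C_{ij})\left(2\langle\widehat{x}_i,\widehat{c}_j\rangle+\widehat{a}_i+\widehat{b}_j-\log(C_{ij})\right)^2,\qquad f(C)=\min(C,10)^{3/4},$$ and let $g^*_m=\inf_{\widehat{x},\widehat{c},\widehat{a},\widehat{b}}g(\widehat{x},\widehat{c},\widehat{a},\widehat{b})$ be its global minimum value for the corpus of size $m$. Put $x'_i=x_i/\sigma$, $a'_i=a_i^m-\|x_i\|_2^2/\sigma^2$ and $b'_i=b_i^m-\|x_i\|_2^2/\sigma^2$. Then for any $\varepsilon>0$ and $\delta>0$ there exists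 some $m$ such that $$\mathbb{P}\left(\left|g(x',x',a',b')-g^*_m\right|>\delta\right)<\varepsilon .$$
   Context: The number of points $n$, the dimension $d$, the points $x_i$ and $\sigma$ are fixed; only $m$ (the corpus size) varies, and $C_{ij}$, $g$ and $g^*_m$ are random and depend on $m$. The initial state of the chain is arbitrary, and $X_t=x_j$ means that the chain is in the state indexed by $j$. Conventions: $-\log0=+\infty$; in $g$, terms with $C_{ij}=0$ are $0$ because $f(0)=0$. *)

theory Defs
  imports "HOL-Probability.Probability"
begin

text \<open>
  Points are indexed by a finite type \<open>'n\<close>, and the chain lives on the indices: coinciding points
  are different states. Conditional probabilities are only constrained for histories of
  positive probability (the library's conditional probability is 0 otherwise). The law of \<open>X 0\<close>
  is unconstrained.
\<close>

definition markov_chain :: "'w measure \<Rightarrow> ('s \<Rightarrow> 's \<Rightarrow> real) \<Rightarrow> (nat \<Rightarrow> 'w \<Rightarrow> 's) \<Rightarrow> bool" where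
  "markov_chain M K X \<longleftrightarrow>
     prob_space M \<and>
     (\<forall>t. X t \<in> measurable M (count_space UNIV)) \<and>
     (\<forall>t h j. \<P>(\<omega> in M. \<forall>s\<le>t. X s \<omega> = h s) > 0 \<longrightarrow>
        \<P>(\<omega> in M. X (Suc t) \<omega> = j \<bar> \<forall>s\<le>t. X s \<omega> = h s) = K (h t) j)"

definition gauss_kernel :: "('n::finite \<Rightarrow> real ^ 'd) \<Rightarrow> real \<Rightarrow> 'n \<Rightarrow> 'n \<Rightarrow> real" where
  "gauss_kernel x \<sigma> i j =
     exp (- (norm (x i - x j))\<^sup>2 / \<sigma>\<^sup>2) / (\<Sum>k\<in>UNIV. exp (- (norm (x i - x k))\<^sup>2 / \<sigma>\<^sup>2))"

definition cooc :: "(nat \<Rightarrow> 'w \<Rightarrow> 's) \<Rightarrow> nat \<Rightarrow> 'w \<Rightarrow> 's \<Rightarrow> 's \<Rightarrow> nat" where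
  "cooc X m \<omega> i j = card {t \<in> {1..m}. X (t - 1) \<omega> = i \<and> X t \<omega> = j}"

text \<open>Logarithm of a count with the convention \<open>log 0 = -\<infinity>\<close>.\<close>

definition elog :: "nat \<Rightarrow> ereal" where
  "elog c = (if c = 0 then - \<infinity> else ereal (ln (real c)))"

definition tendsto_zero_in_prob :: "'w measure \<Rightarrow> (nat \<Rightarrow> 'w \<Rightarrow> ereal) \<Rightarrow> bool" where
  "tendsto_zero_in_prob M Z \<longleftrightarrow>
     (\<forall>e>0. (\<lambda>m. \<P>(\<omega> in M. \<bar>Z m \<omega>\<bar> > ereal e)) \<longlonglongrightarrow> 0)"

definition glove_weight :: "real \<Rightarrow> real" where
  "glove_weight C = (min C 10) powr (3/4)"

text \<open>
  The library's \<open>ln 0\<close> is a real number, and \<open>glove_weight 0 = 0\<close>, so terms with \<open>C i j = 0\<close>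
  contribute 0.
\<close>

definition glove_obj ::
  "('n::finite \<Rightarrow> 'n \<Rightarrow> nat) \<Rightarrow> ('n \<Rightarrow> real ^ 'd) \<Rightarrow> ('n \<Rightarrow> real ^ 'd) \<Rightarrow> ('n \<Rightarrow> real) \<Rightarrow> ('n \<Rightarrow> real) \<Rightarrow> real"
where
  "glove_obj C xh ch ah bh =
     (\<Sum>i\<in>UNIV. \<Sum>j\<in>UNIV. glove_weight (real (C i j)) *
        (2 * (xh i \<bullet> ch j) + ah i + bh j - ln (real (C i j)))\<^sup>2)"

text \<open>
  The infimum is over a nonempty set of nonnegative reals. The argument \<open>TYPE('d)\<close> carries the
  embedding dimension, which the counts alone do not determine.
\<close>

definition glove_min :: "'d::finite itself \<Rightarrow> ('n::finite \<Rightarrow> 'n \<Rightarrow> nat) \<Rightarrow> real" where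
  "glove_min _ C =
     Inf {glove_obj C xh ch ah bh | (xh :: 'n \<Rightarrow> real ^ 'd) (ch :: 'n \<Rightarrow> real ^ 'd) ah bh. True}"

end

theory Submission
  imports Defs
begin

text \<open>
  Expanding \<open>\<parallel>x i - x j\<parallel>\<^sup>2\<close> shows that the residual of the GloVe objective at the candidate point is
  exactly the expression that the hypothesis makes uniformly small. If all residuals are at most
  \<open>e\<close>, then \<open>0 \<le> g\<^sup>* \<le> g \<le> 10 n\<^sup>2 e\<^sup>2\<close>, because the weights lie in \<open>[0, 10]\<close>. A finite supremum
  also excludes zero counts, whose residual is infinite.
\<close>

lemma glove_weight_nonneg: "0 \<le> glove_weight C"
  by (simp add: glove_weight_def)

lemma glove_weight_le_10:
  assumes "0 \<le> C"
  shows "glove_weight C \<le> 10"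
proof -
  have "glove_weight C \<le> 10 powr (3/4)"
    unfolding glove_weight_def using assms by (intro powr_mono2) auto
  also have "\<dots> \<le> 10 powr 1"
    by (intro powr_mono) auto
  finally show ?thesis by simp
qed

lemma glove_obj_nonneg: "0 \<le> glove_obj C xh ch ah bh"
  unfolding glove_obj_def by (intro sum_nonneg mult_nonneg_nonneg glove_weight_nonneg) auto

lemma glove_min_nonneg: "0 \<le> glove_min TYPE('d::finite) C"
  unfolding glove_min_def by (rule cInf_greatest) (blast, auto simp: glove_obj_nonneg)

lemma glove_min_le:
  fixes xh ch :: "'n::finite \<Rightarrow> real ^ 'd"
  shows "glove_min TYPE('d) C \<le> glove_obj C xh ch ah bh"
  unfolding glove_min_def
  by (rule cInf_lower) (auto intro!: bdd_belowI[where m = 0] simp: glove_obj_nonneg)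

lemma glove_obj_le:
  fixes xh ch :: "'n::finite \<Rightarrow> real ^ 'd"
  assumes "\<And>i j. \<bar>2 * (xh i \<bullet> ch j) + ah i + bh j - ln (real (C i j))\<bar> \<le> e"
  shows "glove_obj C xh ch ah bh \<le> 10 * (real CARD('n))\<^sup>2 * e\<^sup>2"
proof -
  \<comment> \<open>Comparing squares requires \<open>0 \<le> e\<close>, which the hypothesis gives
    because an absolute value is nonnegative.\<close>
  have "glove_obj C xh ch ah bh \<le> (\<Sum>i\<in>(UNIV::'n set). \<Sum>j\<in>(UNIV::'n set). 10 * e\<^sup>2)"
    unfolding glove_obj_def
    by (intro sum_mono mult_mono glove_weight_le_10 glove_weight_nonneg)
      (auto intro!: power2_le_iff_abs_le[THEN iffD2] assms order_trans[OF abs_ge_zero assms])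
  then show ?thesis
    by (simp add: power2_eq_square mult_ac)
qed

text \<open>Polarization: \<open>2 * (u \<bullet> v)\<close> minus both squared norms is minus the
  squared norm of \<open>u - v\<close>. The right side keeps the order of summands in the
  convergence hypothesis.\<close>

lemma glove_residual_eq:
  fixes u v :: "'a::real_inner"
  assumes "\<sigma> \<noteq> 0"
  shows "2 * ((u /\<^sub>R \<sigma>) \<bullet> (v /\<^sub>R \<sigma>)) + (\<alpha> - (norm u)\<^sup>2 / \<sigma>\<^sup>2) + (\<beta> - (norm v)\<^sup>2 / \<sigma>\<^sup>2) - l
    = - l - (norm (u - v))\<^sup>2 / \<sigma>\<^sup>2 + \<alpha> + \<beta>"
  unfolding power2_norm_eq_inner using assms
  by (simp add: inner_diff inner_commute power2_eq_square divide_simps)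

text \<open>For \<open>c = 0\<close> the extended residual is infinite, so the assumption fails and
  the library value of \<open>ln 0\<close> never matters. For positive \<open>c\<close> both sides
  are the same real inequality.\<close>

lemma abs_residual_le_of_elog:
  assumes "\<bar>- elog c - ereal d + ereal \<alpha> + ereal \<beta>\<bar> \<le> ereal e"
  shows "\<bar>- ln (real c) - d + \<alpha> + \<beta>\<bar> \<le> e"
  using assms by (cases "c = 0") (auto simp: elog_def)

text \<open>The count is a finite sum of indicators of measurable events.\<close>

lemma measurable_cooc:
  fixes X :: "nat \<Rightarrow> 'w \<Rightarrow> 's::countable"
  assumes [measurable]: "\<And>t. X t \<in> measurable M (count_space UNIV)"
  shows "(\<lambda>\<omega>. cooc X m \<omega> i j) \<in> measurable M (count_space UNIV)"
proof -
  have "cooc X m \<omega> i j = (\<Sum>t\<in>{1..m}. if X (t - 1) \<omega> = i \<and> X t \<omega> = j then 1 else 0)" for \<omega>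
    by (simp add: cooc_def sum.If_cases Int_def)
  then show ?thesis by simp
qed

theorem theoremS1p4:
  fixes M :: "'w measure"
    and x :: "'n::finite \<Rightarrow> real ^ 'd"
    and \<sigma> :: real
    and X :: "nat \<Rightarrow> 'w \<Rightarrow> 'n"
    and a b :: "nat \<Rightarrow> 'n \<Rightarrow> real"
    and \<epsilon> \<delta> :: real
  assumes sigma_pos: "\<sigma> > 0"
    and chain: "markov_chain M (gauss_kernel x \<sigma>) X"
    and conv: "tendsto_zero_in_prob M (\<lambda>m \<omega>. SUP (i, j) \<in> UNIV.
        \<bar>- elog (cooc X m \<omega> i j) - ereal ((norm (x i - x j))\<^sup>2 / \<sigma>\<^sup>2)
          + ereal (a m i) + ereal (b m j)\<bar>)"
    and eps_pos: "\<epsilon> > 0"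
    and delta_pos: "\<delta> > 0"
  shows "\<exists>m\<ge>1.
    \<P>(\<omega> in M.
      \<bar>glove_obj (cooc X m \<omega>) (\<lambda>i. x i /\<^sub>R \<sigma>) (\<lambda>i. x i /\<^sub>R \<sigma>)
          (\<lambda>i. a m i - (norm (x i))\<^sup>2 / \<sigma>\<^sup>2) (\<lambda>i. b m i - (norm (x i))\<^sup>2 / \<sigma>\<^sup>2)
        - glove_min TYPE('d) (cooc X m \<omega>)\<bar> > \<delta>) < \<epsilon>"
proof -
  define Z where "Z m \<omega> = (SUP (i, j) \<in> UNIV.
      \<bar>- elog (cooc X m \<omega> i j) - ereal ((norm (x i - x j))\<^sup>2 / \<sigma>\<^sup>2)
        + ereal (a m i) + ereal (b m j)\<bar>)" for m \<omega>
  define G where "G m \<omega> = glove_obj (cooc X m \<omega>) (\<lambda>i. x i /\<^sub>R \<sigma>) (\<lambda>i. x i /\<^sub>R \<sigma>)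
      (\<lambda>i. a m i - (norm (x i))\<^sup>2 / \<sigma>\<^sup>2) (\<lambda>i. b m i - (norm (x i))\<^sup>2 / \<sigma>\<^sup>2)" for m \<omega>
  interpret prob_space M
    using chain by (simp add: markov_chain_def)
  have X: "X t \<in> measurable M (count_space UNIV)" for t
    using chain by (simp add: markov_chain_def)
  have [measurable]: "(\<lambda>\<omega>. elog (cooc X m \<omega> i j)) \<in> borel_measurable M" for m i j
    using measurable_cooc[OF X] by (rule measurable_compose) simp
  \<comment> \<open>The final monotonicity step requires the larger event, defined by
    \<open>Z m\<close>, to be measurable.\<close>
  have [measurable]: "Z m \<in> borel_measurable M" for m
    unfolding Z_def by (rule borel_measurable_SUP) (auto simp: split_beta)

  \<comment> \<open>Chosen so that the bound of \<open>glove_obj_le\<close> is exactly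
    \<open>\<delta>\<close>.\<close>
  define e where "e = sqrt (\<delta> / (10 * (real CARD('n))\<^sup>2))"
  have e_pos: "e > 0" and e_sq: "10 * (real CARD('n))\<^sup>2 * e\<^sup>2 = \<delta>"
    using delta_pos by (simp_all add: e_def)

  have close: "\<bar>G m \<omega> - glove_min TYPE('d) (cooc X m \<omega>)\<bar> \<le> \<delta>" if "\<bar>Z m \<omega>\<bar> \<le> ereal e" for m \<omega>
  proof -
    have "Z m \<omega> \<le> ereal e"
      using that by (cases "Z m \<omega>") auto
    then have "\<bar>- elog (cooc X m \<omega> i j) - ereal ((norm (x i - x j))\<^sup>2 / \<sigma>\<^sup>2)
        + ereal (a m i) + ereal (b m j)\<bar> \<le> ereal e" for i j
      unfolding Z_def SUP_le_iff by auto
    \<comment> \<open>The deleted simp rules would pull the scalars out of the inner product and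
      destroy the left side of \<open>glove_residual_eq\<close>.\<close>
    then have "G m \<omega> \<le> \<delta>"
      unfolding G_def e_sq[symmetric] using sigma_pos
      by (intro glove_obj_le) (simp add: glove_residual_eq abs_residual_le_of_elog
          del: inner_scaleR_left inner_scaleR_right)
    \<comment> \<open>The minimum lies between 0 and \<open>G m \<omega>\<close>, so the gap lies
      between 0 and \<open>\<delta>\<close>.\<close>
    then show ?thesis
      using glove_min_nonneg[where 'd = 'd, of "cooc X m \<omega>"]
        glove_min_le[where 'd = 'd, of "cooc X m \<omega>"]
      unfolding G_def by (simp add: abs_le_iff algebra_simps add_increasing2)
  qed

  have "(\<lambda>m. \<P>(\<omega> in M. \<bar>Z m \<omega>\<bar> > ereal e)) \<longlonglongrightarrow> 0"
    using conv e_pos unfolding tendsto_zero_in_prob_def Z_def by blast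
  \<comment> \<open>Convergence alone could select \<open>m = 0\<close>; the second conjunct forces
    a nonempty corpus.\<close>
  then have "\<forall>\<^sub>F m in sequentially. \<P>(\<omega> in M. \<bar>Z m \<omega>\<bar> > ereal e) < \<epsilon> \<and> m \<ge> 1"
    using eps_pos by (intro eventually_conj order_tendstoD(2) eventually_ge_at_top)
  then obtain m where m: "m \<ge> 1" "\<P>(\<omega> in M. \<bar>Z m \<omega>\<bar> > ereal e) < \<epsilon>"
    by (auto dest: eventually_happens)
  \<comment> \<open>By contraposition of \<open>close\<close>, a gap above \<open>\<delta>\<close>
    forces the supremum above \<open>e\<close>.\<close>
  have "\<P>(\<omega> in M. \<bar>G m \<omega> - glove_min TYPE('d) (cooc X m \<omega>)\<bar> > \<delta>)
      \<le> \<P>(\<omega> in M. \<bar>Z m \<omega>\<bar> > ereal e)"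
    using close by (intro finite_measure_mono) (auto simp: not_le[symmetric])
  with m show ?thesis
    unfolding G_def by (intro exI[of _ m]) simp
qed

end
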